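(* Let $0<\alpha\le 1$ and let $\{\mathcal{N}^{\alpha}_{c}(t)\}_{t\ge 0}$ be the convoluted fractional Poisson process with intensity parameters $\{\lambda_j\}_{j\in\mathbb{Z}}$ and state probabilities $p^{\alpha}_{c}(n,t)=\Pr\{\mathcal{N}^{\alpha}_{c}(t)=n\}$. Then for every $s>0$ the Laplace transform $\tilde{p}^{\alpha}_{c}(n,s)=\int_0^\infty e^{-st}p^{\alpha}_{c}(n,t)\,\mathrm{d}t$ is given by $$\tilde{p}^{\alpha}_{c}(n,s)=\begin{cases}\dfrac{s^{\alpha-1}}{s^{\alpha}+\lambda_{0}}, & n=0,\\[2mm] \displaystyle\sum_{k=1}^{n}\sum_{\Theta_{n}^{k}}k!\prod_{j=1}^{n}\frac{(\lambda_{j-1}-\lambda_{j})^{k_{j}}}{k_{j}!}\,\frac{s^{\alpha-1}}{(s^{\alpha}+\lambda_{0})^{k+1}}, & n\ge 1,\end{cases}$$ where the inner sum runs over $\Theta_{n}^{k}=\{(k_{1},\dots,k_{n}):\sum_{j=1}^{n}k_{j}=k,\ \sum_{j=1}^{n}jk_{j}=n,\ k_{j}\in\mathbb{N}_0\}$.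
   Context: $\mathbb{N}_0$ denotes the non-negative integers; $0^0=1$. Intensity parameters: $\{\lambda_j\}_{j\in\mathbb{Z}}$ are real numbers with $\lambda_j=0$ for $j<0$, $\lambda_0>0$, $\lambda_j\ge 0$ for $j>0$, non-increasing for $j\ge 0$, and $\lim_{j\to\infty}\lambda_{j+1}/\lambda_j<1$ (this limit condition is regarded as satisfied if $\lambda_j=0$ for all large $j$). Fractional derivative (Dzhrbashyan–Caputo): $\partial_t^{\alpha}f(t)=\frac{1}{\Gamma(1-\alpha)}\int_0^t (t-s)^{-\alpha}f'(s)\,\mathrm{d}s$ for $0<\alpha<1$, and $\partial_t^{1}f(t)=f'(t)$. Convoluted fractional Poisson process (CFPP): an $\mathbb{N}_0$-valued stochastic process $\{\mathcal{N}^{\alpha}_{c}(t)\}_{t\ge0}$ whose state probabilities $p^{\alpha}_{c}(n,t)=\Pr\{\mathcal{N}^{\alpha}_{c}(t)=n\}$ satisfy, for all $n\ge 0$, $$\partial_t^{\alpha}p^{\alpha}_{c}(n,t)=-\lambda_n * p^{\alpha}_{c}(n,t)+\lambda_{n-1}*p^{\alpha}_{c}(n-1,t),$$ where $\lambda_n*p^{\alpha}_{c}(n,t)=\sum_{j=-\infty}^{\infty}\lambda_j p^{\alpha}_{c}(n-j,t)$ is the discrete convolution in the space variable, with $p^{\alpha}_{c}(0,0)=1$, $p^{\alpha}_{c}(n,0)=0$ for $n\ge 1$, and $p^{\alpha}_{c}(-n,t)=0$ for $n\ge 1$, $t\ge 0$. Equivalently, $\partial_t^{\alpha}p^{\alpha}_{c}(n,t)=-\lambda_0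 p^{\alpha}_{c}(n,t)+\sum_{j=1}^{n}(\lambda_{j-1}-\lambda_j)p^{\alpha}_{c}(n-j,t)$. *)

theory Defs
  imports "HOL-Probability.Probability"
begin

text \<open>The Dzhrbashyan--Caputo derivative of order \<open>0 < \<alpha> \<le> 1\<close>.\<close>

definition caputo_deriv :: "real \<Rightarrow> (real \<Rightarrow> real) \<Rightarrow> real \<Rightarrow> real" where
  "caputo_deriv \<alpha> f t =
     (if \<alpha> = 1 then deriv f t
      else (LINT s:{0<..<t}|lborel. (t - s) powr (-\<alpha>) * deriv f s) / Gamma (1 - \<alpha>))"

text \<open>
  As \<^const>\<open>caputo_deriv\<close> is a total function, the existence of the derivative and of the
  integral in its definition has to be stated separately. The function need not be differentiable
  at \<open>0\<close>: for \<open>\<alpha> < 1\<close> solutions of fractional equations typically behave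
  like \<open>f 0 + c * t powr \<alpha>\<close> there. Continuity at \<open>0\<close> ties the values for \<open>t > 0\<close>
  to the initial value.
\<close>

definition caputo_differentiable :: "real \<Rightarrow> (real \<Rightarrow> real) \<Rightarrow> bool" where
  "caputo_differentiable \<alpha> f \<longleftrightarrow>
     continuous_on {0..} f \<and>
     (\<forall>t>0. f differentiable (at t)) \<and>
     (\<alpha> < 1 \<longrightarrow>
       (\<forall>t>0. set_integrable lborel {0<..<t} (\<lambda>s. (t - s) powr (-\<alpha>) * deriv f s)))"

definition discrete_convolution :: "(int \<Rightarrow> real) \<Rightarrow> (int \<Rightarrow> real) \<Rightarrow> int \<Rightarrow> real" where
  "discrete_convolution a b n = (\<Sum>\<^sub>\<infinity>j\<in>UNIV. a j * b (n - j))"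

definition intensity_parameters :: "(int \<Rightarrow> real) \<Rightarrow> bool" where
  "intensity_parameters lam \<longleftrightarrow>
     (\<forall>j<0. lam j = 0) \<and> lam 0 > 0 \<and> (\<forall>j>0. lam j \<ge> 0) \<and>
     (\<forall>i j. 0 \<le> i \<and> i \<le> j \<longrightarrow> lam j \<le> lam i) \<and>
     ((\<exists>l<1. ((\<lambda>j. lam (j + 1) / lam j) \<longlongrightarrow> l) at_top) \<or>
      (\<forall>\<^sub>F j in at_top. lam j = 0))"

text \<open>
  State probabilities are indexed by integers, so that they vanish at negative states and can be
  convolved with the intensities.
\<close>

definition state_prob :: "'w measure \<Rightarrow> (real \<Rightarrow> 'w \<Rightarrow> nat) \<Rightarrow> int \<Rightarrow> real \<Rightarrow> real" where
  "state_prob M N n t = measure M {\<omega> \<in> space M. int (N t \<omega>) = n}"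

definition convoluted_fractional_poisson ::
  "'w measure \<Rightarrow> real \<Rightarrow> (int \<Rightarrow> real) \<Rightarrow> (real \<Rightarrow> 'w \<Rightarrow> nat) \<Rightarrow> bool" where
  "convoluted_fractional_poisson M \<alpha> lam N \<longleftrightarrow>
     prob_space M \<and>
     (\<forall>t\<ge>0. N t \<in> measurable M (count_space UNIV)) \<and>
     (\<forall>n\<ge>0. caputo_differentiable \<alpha> (state_prob M N n)) \<and>
     (\<forall>n\<ge>0. \<forall>t>0.
        caputo_deriv \<alpha> (state_prob M N n) t =
          - discrete_convolution lam (\<lambda>m. state_prob M N m t) n
          + discrete_convolution lam (\<lambda>m. state_prob M N m t) (n - 1)) \<and>
     state_prob M N 0 0 = 1 \<and>
     (\<forall>n\<ge>1. state_prob M N n 0 = 0)"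

definition laplace_transform :: "(real \<Rightarrow> real) \<Rightarrow> real \<Rightarrow> real" where
  "laplace_transform f s = (LINT t:{0..}|lborel. exp (- (s * t)) * f t)"

text \<open>
  The tuples \<open>(k\<^sub>1, \<dots>, k\<^sub>n)\<close> are represented as functions that are \<^const>\<open>undefined\<close>
  outside \<open>{1..n}\<close>, so that each tuple occurs exactly once.
\<close>

definition Theta :: "nat \<Rightarrow> nat \<Rightarrow> (nat \<Rightarrow> nat) set" where
  "Theta n k =
     {\<kappa> \<in> {1..n} \<rightarrow>\<^sub>E UNIV. (\<Sum>j=1..n. \<kappa> j) = k \<and> (\<Sum>j=1..n. j * \<kappa> j) = n}"

end

theory Submission
  imports Defs
begin

text \<open>
  The differential equation does not by itself bound the growth of the derivative of a state
  probability, so it cannot be Laplace transformed directly. Applying the fractional integral of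
  order \<open>\<alpha>\<close> instead turns it into \<open>p(t) - p(0) = (t powr (\<alpha> - 1) / Gamma \<alpha>) * g\<close>, a convolution
  with a bounded continuous right-hand side \<open>g\<close>. All Laplace integrals then converge absolutely, and
  \<open>s powr \<alpha> * L p - s powr (\<alpha> - 1) * p(0) = L g\<close>. This is a recursion in \<open>n\<close> for the transforms,
  with weights \<open>d j = lam (j - 1) - lam j\<close>. It is solved by the sums over \<open>Theta n k\<close>, which are the
  coefficients of \<open>x ^ n\<close> in \<open>(\<Sum>j. d j * x ^ j) ^ k\<close>.
\<close>

section \<open>Combinatorics: coefficients of powers of a polynomial without constant term\<close>

text \<open>
  The number \<open>m\<close> of entries is independent of \<open>n\<close>, unlike in \<open>Theta\<close>: lowering one entry
  by \<open>1\<close> changes \<open>n\<close> but must not change the index set of the tuple.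
\<close>

definition weighted_compositions :: "nat \<Rightarrow> nat \<Rightarrow> nat \<Rightarrow> (nat \<Rightarrow> nat) set" where
  "weighted_compositions m n k =
     {\<kappa> \<in> {1..m} \<rightarrow>\<^sub>E UNIV. (\<Sum>j=1..m. \<kappa> j) = k \<and> (\<Sum>j=1..m. j * \<kappa> j) = n}"

text \<open>By the multinomial theorem, the coefficient of \<open>x ^ n\<close> in
  \<open>(\<Sum>j=1..m. d j * x ^ j) ^ k\<close>; the entry \<open>\<kappa> j\<close> counts the
  factors that contribute \<open>d j * x ^ j\<close>.\<close>

definition composition_sum :: "(nat \<Rightarrow> real) \<Rightarrow> nat \<Rightarrow> nat \<Rightarrow> nat \<Rightarrow> real" where
  "composition_sum d m n k =
     (\<Sum>\<kappa>\<in>weighted_compositions m n k. fact k * (\<Prod>j=1..m. d j ^ \<kappa> j / fact (\<kappa> j)))"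

text \<open>One factor is split off the power with exponent \<open>k + 1\<close>: it contributes
  \<open>d j * x ^ j\<close>, and the other \<open>k\<close> factors supply
  \<open>x ^ (n - j)\<close>. The hypothesis \<open>n \<le> m\<close> makes every such
  \<open>j\<close> available.\<close>

lemma composition_sum_Suc:
  assumes "n \<le> m"
  shows "composition_sum d m n (Suc k) = (\<Sum>j=1..n. d j * composition_sum d m (n - j) k)"
proof -
  let ?W = weighted_compositions
  let ?w = "\<lambda>\<kappa>. \<Prod>j=1..m. d j ^ \<kappa> j / fact (\<kappa> j)"
  have finW: "finite (?W m n (Suc k))"
  proof (rule finite_subset)
    show "?W m n (Suc k) \<subseteq> {1..m} \<rightarrow>\<^sub>E {..Suc k}"
    proof
      fix \<kappa> assume \<kappa>: "\<kappa> \<in> ?W m n (Suc k)"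
      have "\<kappa> j \<le> Suc k" if "j \<in> {1..m}" for j
        using member_le_sum[OF that, of \<kappa>] \<kappa> by (simp add: weighted_compositions_def)
      then show "\<kappa> \<in> {1..m} \<rightarrow>\<^sub>E {..Suc k}"
        using \<kappa> by (auto simp: weighted_compositions_def PiE_iff)
    qed
  qed (simp add: finite_PiE)
  \<comment> \<open>the factor \<open>k + 1\<close> of \<open>(k + 1)!\<close> is distributed over the entries of \<open>\<kappa>\<close>, and \<open>\<kappa> j\<close> cancels against \<open>(\<kappa> j)!\<close>\<close>
  have term_eq: "fact k * (real (\<kappa> j) * ?w \<kappa>) = d j * (fact k * ?w (\<kappa>(j := \<kappa> j - 1)))"
    if j: "j \<in> {1..m}" and pos: "\<kappa> j \<noteq> 0" for \<kappa> j
  proof -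
    obtain q where q: "\<kappa> j = Suc q" using pos not0_implies_Suc by blast
    define P where "P = (\<Prod>i\<in>{1..m}-{j}. d i ^ \<kappa> i / fact (\<kappa> i))"
    have "?w (\<kappa>(j := q)) = d j ^ q / fact q * P"
      unfolding P_def using j by (subst prod.remove[of _ j]) (auto intro!: prod.cong)
    moreover have "?w \<kappa> = d j ^ Suc q / fact (Suc q) * P"
      unfolding P_def using j q by (subst prod.remove[of _ j]) auto
    moreover have "real (Suc q) * (d j ^ Suc q / fact (Suc q) * P) = d j * (d j ^ q / fact q * P)"
      by (simp add: fact_Suc del: of_nat_Suc)
    ultimately show ?thesis
      unfolding q diff_Suc_1 by (simp only: mult.left_commute)
  qed
  have weight_split: "(\<Sum>i=1..m. \<kappa> i) = \<kappa> j + (\<Sum>i\<in>{1..m}-{j}. \<kappa> i)"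
      "(\<Sum>i=1..m. i * \<kappa> i) = j * \<kappa> j + (\<Sum>i\<in>{1..m}-{j}. i * \<kappa> i)"
    if "j \<in> {1..m}" for \<kappa> :: "nat \<Rightarrow> nat" and j
    using that by (auto simp: sum.remove)
  have restr: "(\<Sum>i\<in>{1..m}-{j}. (\<kappa>(j := a)) i) = (\<Sum>i\<in>{1..m}-{j}. \<kappa> i)"
      "(\<Sum>i\<in>{1..m}-{j}. i * (\<kappa>(j := a)) i) = (\<Sum>i\<in>{1..m}-{j}. i * \<kappa> i)"
    for \<kappa> :: "nat \<Rightarrow> nat" and j a
    by (auto intro!: sum.cong)
  \<comment> \<open>Lowering entry \<open>j\<close> by 1 removes one part of size \<open>j\<close>:
    the count drops from \<open>k + 1\<close> to \<open>k\<close> and the weight from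
    \<open>n\<close> to \<open>n - j\<close>. Tuples with \<open>\<kappa> j = 0\<close> contribute
    nothing, and on the others the lowering is invertible.\<close>
  have inner: "(\<Sum>\<kappa>\<in>?W m n (Suc k). fact k * (real (\<kappa> j) * ?w \<kappa>)) =
      (if j \<le> n then d j * composition_sum d m (n - j) k else 0)" if j: "j \<in> {1..m}" for j
  proof -
    have "(\<Sum>\<kappa>\<in>?W m n (Suc k). fact k * (real (\<kappa> j) * ?w \<kappa>)) =
        (\<Sum>\<kappa>\<in>{\<kappa>\<in>?W m n (Suc k). \<kappa> j \<noteq> 0}. fact k * (real (\<kappa> j) * ?w \<kappa>))"
      using finW by (intro sum.mono_neutral_right) auto
    \<comment> \<open>The case distinction guards against truncated subtraction: for
      \<open>j > n\<close> no tuple contains a part \<open>j\<close>, yet \<open>n - j\<close> would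
      be 0.\<close>
    also have "\<dots> = (if j \<le> n then \<Sum>\<kappa>\<in>?W m (n - j) k. d j * (fact k * ?w \<kappa>) else 0)"
    proof (cases "j \<le> n")
      case True
      have "(\<Sum>\<kappa>\<in>{\<kappa>\<in>?W m n (Suc k). \<kappa> j \<noteq> 0}. fact k * (real (\<kappa> j) * ?w \<kappa>)) =
          (\<Sum>\<kappa>\<in>?W m (n - j) k. d j * (fact k * ?w \<kappa>))"
      proof (rule sum.reindex_bij_witness[where j="\<lambda>\<kappa>. \<kappa>(j := \<kappa> j - 1)" and i="\<lambda>\<kappa>. \<kappa>(j := Suc (\<kappa> j))"])
        fix \<kappa> assume "\<kappa> \<in> {\<kappa>\<in>?W m n (Suc k). \<kappa> j \<noteq> 0}"
        then have \<kappa>: "\<kappa> \<in> ?W m n (Suc k)" "\<kappa> j \<noteq> 0" by auto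
        obtain q where q: "\<kappa> j = Suc q" using \<kappa> not0_implies_Suc by blast
        show "(\<kappa>(j := \<kappa> j - 1))(j := Suc ((\<kappa>(j := \<kappa> j - 1)) j)) = \<kappa>"
          using \<kappa> by auto
        show "\<kappa>(j := \<kappa> j - 1) \<in> ?W m (n - j) k"
          using \<kappa>(1) j q unfolding weighted_compositions_def mem_Collect_eq weight_split[OF j] restr
          by (auto simp: PiE_iff extensional_def)
        show "d j * (fact k * ?w (\<kappa>(j := \<kappa> j - 1))) = fact k * (real (\<kappa> j) * ?w \<kappa>)"
          using term_eq[of j \<kappa>] j \<kappa>(2) by simp
      next
        fix \<kappa> assume \<kappa>: "\<kappa> \<in> ?W m (n - j) k"
        show "(\<kappa>(j := Suc (\<kappa> j)))(j := (\<kappa>(j := Suc (\<kappa> j))) j - 1) = \<kappa>" by auto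
        show "\<kappa>(j := Suc (\<kappa> j)) \<in> {\<kappa>\<in>?W m n (Suc k). \<kappa> j \<noteq> 0}"
          using \<kappa> j True unfolding weighted_compositions_def mem_Collect_eq weight_split[OF j] restr
          by (auto simp: PiE_iff extensional_def)
      qed
      then show ?thesis using True by simp
    next
      case False
      have "{\<kappa>\<in>?W m n (Suc k). \<kappa> j \<noteq> 0} = {}"
      proof -
        have "\<not> (\<kappa> \<in> ?W m n (Suc k) \<and> \<kappa> j \<noteq> 0)" for \<kappa>
        proof
          assume \<kappa>: "\<kappa> \<in> ?W m n (Suc k) \<and> \<kappa> j \<noteq> 0"
          then have "j * \<kappa> j \<le> n"
            using weight_split(2)[OF j, of \<kappa>] by (simp add: weighted_compositions_def)
          moreover have "j \<le> j * \<kappa> j" using \<kappa> by simp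
          ultimately show False using False by linarith
        qed
        then show ?thesis by blast
      qed
      then show ?thesis using False by (simp only: if_False sum.empty)
    qed
    finally show ?thesis
      by (simp add: composition_sum_def sum_distrib_left)
  qed
  have "composition_sum d m n (Suc k) =
      (\<Sum>\<kappa>\<in>?W m n (Suc k). \<Sum>j=1..m. fact k * (real (\<kappa> j) * ?w \<kappa>))"
    unfolding composition_sum_def
  proof (rule sum.cong[OF refl])
    fix \<kappa> assume \<kappa>: "\<kappa> \<in> ?W m n (Suc k)"
    have "(\<Sum>j=1..m. fact k * (real (\<kappa> j) * ?w \<kappa>)) = fact k * real (\<Sum>j=1..m. \<kappa> j) * ?w \<kappa>"
      by (simp add: sum_distrib_left sum_distrib_right mult.assoc)
    also have "(\<Sum>j=1..m. \<kappa> j) = Suc k"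
      using \<kappa> by (simp add: weighted_compositions_def)
    finally show "fact (Suc k) * ?w \<kappa> = (\<Sum>j=1..m. fact k * (real (\<kappa> j) * ?w \<kappa>))"
      by (simp add: mult_ac)
  qed
  also have "\<dots> = (\<Sum>j=1..m. if j \<le> n then d j * composition_sum d m (n - j) k else 0)"
    by (subst sum.swap, intro sum.cong refl inner)
  also have "\<dots> = (\<Sum>j=1..n. d j * composition_sum d m (n - j) k)"
    using assms by (intro sum.mono_neutral_cong_right) auto
  finally show ?thesis .
qed

lemma composition_sum_zero_right:
  "composition_sum d m n 0 = (if n = 0 then 1 else 0)"
proof -
  have "\<kappa> \<in> weighted_compositions m n 0 \<longleftrightarrow> n = 0 \<and> \<kappa> = (\<lambda>j\<in>{1..m}. 0)" for \<kappa>
  proof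
    assume \<kappa>: "\<kappa> \<in> weighted_compositions m n 0"
    then have zero: "\<kappa> j = 0" if "j \<in> {1..m}" for j
      using that by (simp add: weighted_compositions_def)
    then have "n = 0"
      using \<kappa> by (simp add: weighted_compositions_def)
    moreover have "\<kappa> = (\<lambda>j\<in>{1..m}. 0)"
    proof (rule extensionalityI[of _ "{1..m}"])
      show "\<kappa> \<in> extensional {1..m}"
        using \<kappa> by (simp add: weighted_compositions_def PiE_def)
    qed (use zero in auto)
    ultimately show "n = 0 \<and> \<kappa> = (\<lambda>j\<in>{1..m}. 0)" by simp
  qed (simp add: weighted_compositions_def)
  then have "weighted_compositions m n 0 = (if n = 0 then {\<lambda>j\<in>{1..m}. 0} else {})"
    by auto
  then show ?thesis by (simp add: composition_sum_def)
qed

text \<open>Every part is at least 1, so \<open>k\<close> parts have total weight at least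
  \<open>k\<close>.\<close>

lemma composition_sum_eq_0:
  assumes "n < k"
  shows "composition_sum d m n k = 0"
proof -
  have "\<kappa> \<notin> weighted_compositions m n k" for \<kappa>
  proof
    assume "\<kappa> \<in> weighted_compositions m n k"
    moreover have "(\<Sum>j=1..m. \<kappa> j) \<le> (\<Sum>j=1..m. j * \<kappa> j)"
      by (intro sum_mono) auto
    ultimately show False using assms by (simp add: weighted_compositions_def)
  qed
  then have "weighted_compositions m n k = {}" by blast
  then show ?thesis by (simp add: composition_sum_def)
qed

lemma sum_Theta_eq_composition_sum:
  "(\<Sum>\<kappa>\<in>Theta n k. fact k * (\<Prod>j=1..n. d j ^ \<kappa> j / fact (\<kappa> j))) = composition_sum d n n k"
  by (simp add: Theta_def composition_sum_def weighted_compositions_def)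

text \<open>Each division by \<open>b\<close> goes with one more factor of the power, so the term
  \<open>k\<close> in the closed form for \<open>n - j\<close> feeds the term \<open>k + 1\<close>
  for \<open>n\<close>. A common bound \<open>m\<close> keeps the range of \<open>k\<close> the same
  for all \<open>n\<close>, which lets the sums over \<open>j\<close> and \<open>k\<close> be
  swapped.\<close>

lemma recursion_eq_composition_sum:
  fixes d L :: "nat \<Rightarrow> real"
  assumes "L 0 = a / b"
    and "\<And>n. 1 \<le> n \<Longrightarrow> L n = (\<Sum>j=1..n. d j * L (n - j)) / b"
  shows "n \<le> m \<Longrightarrow> L n = (\<Sum>k\<le>m. composition_sum d m n k * (a / b ^ (k + 1)))"
proof (induction n rule: less_induct)
  case (less n)
  show ?case
  proof (cases "n = 0")
    case True
    have "(\<Sum>k\<le>m. composition_sum d m 0 k * (a / b ^ (k + 1))) = a / b"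
      by (subst sum.remove[of _ 0])
         (auto simp: composition_sum_zero_right composition_sum_eq_0 intro!: sum.neutral)
    then show ?thesis using True assms(1) by simp
  next
    case False
    have "L n = (\<Sum>j=1..n. d j * (\<Sum>k\<le>m. composition_sum d m (n - j) k * (a / b ^ (k + 1)))) / b"
      using False less by (subst assms(2)) (auto intro!: sum.cong arg_cong[where f="\<lambda>x. x / b"])
    also have "\<dots> = (\<Sum>k\<le>m. (\<Sum>j=1..n. d j * composition_sum d m (n - j) k) * (a / b ^ (k + 2)))"
      unfolding sum_distrib_left sum_divide_distrib sum_distrib_right
      by (subst sum.swap) (auto intro!: sum.cong simp: field_simps)
    also have "\<dots> = (\<Sum>k\<le>m. composition_sum d m n (Suc k) * (a / b ^ (Suc k + 1)))"
      using less.prems by (simp add: composition_sum_Suc)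
    \<comment> \<open>The coefficient for \<open>k = 0\<close> is 0 when \<open>n > 0\<close>, so
      the shifted sum may start at 0 again.\<close>
    also have "\<dots> = (\<Sum>k\<le>Suc m. composition_sum d m n k * (a / b ^ (k + 1)))"
      using False by (subst sum.atMost_Suc_shift) (simp add: composition_sum_zero_right)
    \<comment> \<open>The extra term \<open>k = m + 1\<close> vanishes because
      \<open>n \<le> m\<close>.\<close>
    also have "\<dots> = (\<Sum>k\<le>m. composition_sum d m n k * (a / b ^ (k + 1)))"
      using less.prems by (simp add: composition_sum_eq_0)
    finally show ?thesis .
  qed
qed

section \<open>Lebesgue integrals: convolutions, Beta and Gamma integrals\<close>

text \<open>Transfers the gauge integrals known for Beta and Gamma to Lebesgue integrals;
  nonnegativity makes the convergence absolute.\<close>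

lemma has_bochner_integral_lborel_nonneg:
  fixes f :: "real \<Rightarrow> real"
  assumes [measurable]: "f \<in> borel_measurable borel" "S \<in> sets borel"
    and nonneg: "\<And>x. x \<in> S \<Longrightarrow> 0 \<le> f x" and int: "(f has_integral I) S"
  shows "has_bochner_integral lborel (\<lambda>x. indicator S x * f x) I"
proof (rule has_bochner_integral_nn_integral)
  have "((\<lambda>x. indicator S x * f x) has_integral I) UNIV"
    using int by (subst (asm) has_integral_restrict_UNIV[symmetric])
      (simp add: indicator_def of_bool_def if_distrib if_distribR cong: if_cong)
  then show "(\<integral>\<^sup>+x. ennreal (indicator S x * f x) \<partial>lborel) = ennreal I"
    using nonneg by (intro nn_integral_has_integral_lborel) (auto simp: indicator_def)
  show "0 \<le> I" using has_integral_nonneg[OF int] nonneg by auto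
qed (use nonneg in \<open>auto simp: indicator_def\<close>)

text \<open>Fubini and translation invariance. Joint integrability holds because the inner integral
  of the absolute value is \<open>\<bar>f u\<bar>\<close> times the L1 norm of
  \<open>g\<close>.\<close>

lemma integral_convolution:
  fixes f g :: "real \<Rightarrow> real"
  assumes f: "integrable lborel f" and g: "integrable lborel g"
  shows "(\<integral>t. (\<integral>u. f u * g (t - u) \<partial>lborel) \<partial>lborel) = (\<integral>u. f u \<partial>lborel) * (\<integral>v. g v \<partial>lborel)"
proof -
  have [measurable]: "f \<in> borel_measurable borel" "g \<in> borel_measurable borel"
    using f g by auto
  have shift: "integrable lborel (\<lambda>t. h (t - u))"
      "(\<integral>t. h (t - u) \<partial>lborel) = (\<integral>t. h t \<partial>lborel)"
    if "integrable lborel h" for h :: "real \<Rightarrow> real" and u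
    using lborel_integrable_real_affine[OF that, of 1 "-u"] lborel_integral_real_affine[of 1 h "-u"]
    by simp_all
  have int: "integrable (lborel \<Otimes>\<^sub>M lborel) (\<lambda>(u, t). f u * g (t - u))"
  proof (rule lborel_pair.Fubini_integrable)
    have "(\<integral>t. norm (case (u, t) of (u, t) \<Rightarrow> f u * g (t - u)) \<partial>lborel) =
        \<bar>f u\<bar> * (\<integral>t. \<bar>g t\<bar> \<partial>lborel)" for u
      using shift(2)[of "\<lambda>t. \<bar>g t\<bar>" u] g by (simp add: abs_mult)
    then show "integrable lborel (\<lambda>u. \<integral>t. norm (case (u, t) of (u, t) \<Rightarrow> f u * g (t - u)) \<partial>lborel)"
      using f by simp
    show "AE u in lborel. integrable lborel (\<lambda>t. case (u, t) of (u, t) \<Rightarrow> f u * g (t - u))"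
      using shift(1)[OF g] by simp
  qed simp
  have "(\<integral>t. (\<integral>u. f u * g (t - u) \<partial>lborel) \<partial>lborel) = (\<integral>u. (\<integral>t. f u * g (t - u) \<partial>lborel) \<partial>lborel)"
    using lborel_pair.Fubini_integral[OF int] .
  also have "\<dots> = (\<integral>u. f u \<partial>lborel) * (\<integral>v. g v \<partial>lborel)"
    using shift(2)[OF g] by simp
  finally show "(\<integral>t. (\<integral>u. f u * g (t - u) \<partial>lborel) \<partial>lborel) = (\<integral>u. f u \<partial>lborel) * (\<integral>v. g v \<partial>lborel)" .
qed

text \<open>The substitution \<open>u = x + (y - x) * t\<close> carries over the Beta integral from
  the unit interval.\<close>

lemma has_bochner_integral_Beta_interval:
  fixes a b x y :: real
  assumes "0 < a" "0 < b" "x < y"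
  shows "has_bochner_integral lborel
    (\<lambda>u. indicator {x<..<y} u * ((u - x) powr (a - 1) * (y - u) powr (b - 1)))
    (Beta a b * (y - x) powr (a + b - 1))"
proof -
  define h :: "real \<Rightarrow> real" where "h = (\<lambda>t. indicator {0<..<1} t * (t powr (a - 1) * (1 - t) powr (b - 1)))"
  define c where "c = y - x"
  have c: "c > 0" and "y = x + c" using assms c_def by simp_all
  have "has_bochner_integral lborel h (Beta a b)"
    unfolding h_def using has_integral_Beta_real[of a b] assms
    by (intro has_bochner_integral_lborel_nonneg) (auto simp: has_integral_Icc_iff_Ioo)
  then have "has_bochner_integral lborel (\<lambda>u. h (- x / c + 1 / c * u)) (Beta a b / \<bar>1 / c\<bar>)"
    using lborel_has_bochner_integral_real_affine_iff[of "1/c" h "Beta a b" "- x / c"] c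
    by (simp add: field_simps)
  \<comment> \<open>The two powers have total degree \<open>a + b - 2\<close>; this factor turns
    \<open>t\<close> and \<open>1 - t\<close> into \<open>u - x\<close> and
    \<open>y - u\<close>.\<close>
  then have "has_bochner_integral lborel (\<lambda>u. c powr (a + b - 2) * h (- x / c + 1 / c * u))
      (c powr (a + b - 2) * (Beta a b / \<bar>1 / c\<bar>))"
    by (rule has_bochner_integral_mult_right)
  also have "c powr (a + b - 2) * (Beta a b / \<bar>1 / c\<bar>) = Beta a b * c powr (a + b - 1)"
    using c powr_add[of c "a + b - 2" 1] by (simp add: field_simps)
  also have "(\<lambda>u. c powr (a + b - 2) * h (- x / c + 1 / c * u)) =
      (\<lambda>u. indicator {x<..<y} u * ((u - x) powr (a - 1) * (y - u) powr (b - 1)))"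
  proof
    fix u
    have eq: "- x / c + 1 / c * u = (u - x) / c" "1 - (u - x) / c = (y - u) / c"
      using c \<open>y = x + c\<close> by (simp_all add: field_simps)
    have ind: "indicator {0<..<1} ((u - x) / c) = (indicator {x<..<y} u :: real)"
      using c \<open>y = x + c\<close> by (auto simp: indicator_def field_simps)
    show "c powr (a + b - 2) * h (- x / c + 1 / c * u) =
        indicator {x<..<y} u * ((u - x) powr (a - 1) * (y - u) powr (b - 1))"
    proof (cases "u \<in> {x<..<y}")
      case True
      have "c powr (a + b - 2) = c powr (a - 1) * c powr (b - 1)"
        by (simp flip: powr_add add: algebra_simps)
      then show ?thesis
        using True c unfolding h_def eq ind by (simp add: powr_divide)
    qed (simp only: h_def eq ind, simp)
  qed
  finally show ?thesis by (simp add: c_def)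
qed

text \<open>The Gamma integral rescaled by \<open>s\<close>: it is the Laplace transform of the
  fractional integral kernel, up to the factor \<open>Gamma \<alpha>\<close>.\<close>

lemma has_bochner_integral_Gamma_kernel:
  fixes \<alpha> s :: real
  assumes "0 < \<alpha>" "0 < s"
  shows "has_bochner_integral lborel
    (\<lambda>t. indicator {0<..} t * (exp (- (s * t)) * t powr (\<alpha> - 1))) (Gamma \<alpha> / s powr \<alpha>)"
proof -
  define h :: "real \<Rightarrow> real" where "h = (\<lambda>t. indicator {0..} t * (t powr (\<alpha> - 1) / exp t))"
  have "has_bochner_integral lborel h (Gamma \<alpha>)"
    unfolding h_def using Gamma_integral_real[of \<alpha>] assms
    by (intro has_bochner_integral_lborel_nonneg) auto
  then have "has_bochner_integral lborel (\<lambda>t. h (0 + s * t)) (Gamma \<alpha> / s)"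
    using lborel_has_bochner_integral_real_affine_iff[of s h "Gamma \<alpha>" 0] assms by (simp add: divide_inverse mult.commute)
  then have "has_bochner_integral lborel (\<lambda>t. h (0 + s * t) / s powr (\<alpha> - 1)) (Gamma \<alpha> / s / s powr (\<alpha> - 1))"
    by (rule has_bochner_integral_divide_zero)
  also have "Gamma \<alpha> / s / s powr (\<alpha> - 1) = Gamma \<alpha> / s powr \<alpha>"
    using assms powr_add[of s "\<alpha> - 1" 1] by (simp add: field_simps)
  \<comment> \<open>The closed and the open half-line agree here, since
    \<open>0 powr (\<alpha> - 1) = 0\<close>.\<close>
  also have "(\<lambda>t. h (0 + s * t) / s powr (\<alpha> - 1)) =
      (\<lambda>t. indicator {0<..} t * (exp (- (s * t)) * t powr (\<alpha> - 1)))"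
    using assms
    by (auto simp: h_def fun_eq_iff indicator_def powr_mult exp_minus field_simps zero_le_mult_iff)
  finally show ?thesis .
qed

section \<open>Fractional calculus: inverting the Caputo derivative, and its Laplace
  transform\<close>

text \<open>
  The kernels of the Caputo derivative and of the fractional integral compose to the constant
  \<open>Beta \<alpha> (1 - \<alpha>)\<close>, so by Fubini the fractional integral inverts the derivative.
\<close>

lemma fractional_integral_caputo_deriv:
  assumes \<alpha>: "0 < \<alpha>" "\<alpha> \<le> 1" and f: "caputo_differentiable \<alpha> f" and T: "0 < T"
    and int1: "\<alpha> = 1 \<Longrightarrow> set_integrable lborel {0<..<T} (caputo_deriv \<alpha> f)"
  shows "(\<integral>u. indicator {0<..<T} u * ((T - u) powr (\<alpha> - 1) * caputo_deriv \<alpha> f u) \<partial>lborel) =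
    Gamma \<alpha> * (f T - f 0)"
proof -
  define D where "D = (\<lambda>x. indicator {0<..<T} x * deriv f x)"
  \<comment> \<open>For \<open>\<alpha> < 1\<close> integrability is given only with the weight
    \<open>(T - x) powr (-\<alpha>)\<close>; multiplying by
    \<open>(T - x) powr \<alpha> \<le> T powr \<alpha>\<close> removes it. For
    \<open>\<alpha> = 1\<close> it is the hypothesis \<open>int1\<close>.\<close>
  have D_int: "integrable lborel D"
  proof (cases "\<alpha> = 1")
    case True
    then show ?thesis using int1 by (simp add: D_def set_integrable_def caputo_deriv_def)
  next
    case False
    let ?g = "\<lambda>x. indicator {0<..<T} x *\<^sub>R ((T - x) powr (-\<alpha>) * deriv f x)"
    have g: "integrable lborel ?g"
      using f T False \<alpha> unfolding caputo_differentiable_def set_integrable_def by auto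
    have eq: "D = (\<lambda>x. (T - x) powr \<alpha> * ?g x)"
      by (auto simp: D_def fun_eq_iff indicator_def powr_minus field_simps)
    show ?thesis
    proof (rule Bochner_Integration.integrable_bound)
      show "integrable lborel (\<lambda>x. T powr \<alpha> * ?g x)" using g by simp
      have [measurable]: "?g \<in> borel_measurable borel" using g by (simp add: integrable_iff_bounded)
      show "D \<in> borel_measurable lborel" unfolding eq by measurable
      have "\<bar>(T - x) powr \<alpha> * ?g x\<bar> \<le> \<bar>T powr \<alpha> * ?g x\<bar>" for x
      proof (cases "x \<in> {0<..<T}")
        case True
        then have "(T - x) powr \<alpha> \<le> T powr \<alpha>" using \<alpha> by (intro powr_mono2) auto
        then show ?thesis by (simp add: abs_mult mult_right_mono)
      qed simp
      then show "AE x in lborel. norm (D x) \<le> norm (T powr \<alpha> * ?g x)"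
        unfolding eq by simp
    qed
  qed
  have FTC: "(\<integral>x. D x \<partial>lborel) = f T - f 0"
  proof -
    \<comment> \<open>The derivative may fail to exist at 0, so the version with interior
      differentiability and continuity up to the end points is used.\<close>
    have "(deriv f has_integral (f T - f 0)) {0..T}"
    proof (rule fundamental_theorem_of_calculus_interior)
      show "continuous_on {0..T} f"
        using f by (auto simp: caputo_differentiable_def elim: continuous_on_subset)
      show "(f has_vector_derivative deriv f x) (at x)" if "x \<in> {0<..<T}" for x
        using f that
        by (auto simp: caputo_differentiable_def real_differentiable_def DERIV_imp_deriv
            simp flip: has_real_derivative_iff_has_vector_derivative)
    qed (use T in simp)
    then have "integral {0<..<T} (deriv f) = f T - f 0"
      by (simp add: has_integral_Icc_iff_Ioo integral_unique)
    then show ?thesis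
      using set_borel_integral_eq_integral(2)[of "{0<..<T}" "deriv f"] D_int
      by (simp add: set_integrable_def set_lebesgue_integral_def D_def)
  qed
  show ?thesis
  \<comment> \<open>For \<open>\<alpha> = 1\<close> the kernel is 1 below \<open>T\<close>; the
    general argument cancels \<open>Gamma (1 - \<alpha>)\<close>, which has a pole there.\<close>
  proof (cases "\<alpha> = 1")
    case True
    have "(\<integral>u. indicator {0<..<T} u * ((T - u) powr (\<alpha> - 1) * caputo_deriv \<alpha> f u) \<partial>lborel) =
        (\<integral>x. D x \<partial>lborel)"
      by (intro Bochner_Integration.integral_cong) (auto simp: D_def True caputo_deriv_def indicator_def)
    then show ?thesis using FTC True by simp
  next
    case False
    then have \<alpha>1: "\<alpha> < 1" using \<alpha> by simp
    then have Gamma_nz: "Gamma (1 - \<alpha>) \<noteq> 0"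
      by (intro less_imp_neq[symmetric] Gamma_real_pos) simp
    \<comment> \<open>The product of the two kernels. For every \<open>x < T\<close> its integral
      over \<open>u\<close> is \<open>Gamma (1 - \<alpha>) * Gamma \<alpha>\<close>: the power of
      \<open>T - x\<close> has exponent 0, and \<open>Gamma 1 = 1\<close>.\<close>
    define K where "K = (\<lambda>x u. indicator {x<..<T} u * ((u - x) powr (-\<alpha>) * (T - u) powr (\<alpha> - 1)))"
    have [measurable]: "D \<in> borel_measurable borel" using D_int by auto
    have K_nonneg: "0 \<le> K x u" for x u by (simp add: K_def)
    have K_int: "has_bochner_integral lborel (K x) (Gamma (1 - \<alpha>) * Gamma \<alpha>)" if "x < T" for x
      using has_bochner_integral_Beta_interval[of "1 - \<alpha>" \<alpha> x T] that \<alpha> \<alpha>1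
      by (simp add: K_def Beta_def)
    have K_eq: "K x u = (if x < u \<and> u < T then (u - x) powr (-\<alpha>) * (T - u) powr (\<alpha> - 1) else 0)" for x u
      by (simp add: K_def indicator_def)
    have [measurable]: "(\<lambda>(x, u). K x u) \<in> borel_measurable (borel \<Otimes>\<^sub>M borel)"
      unfolding K_eq by measurable
    \<comment> \<open>For \<open>x \<ge> T\<close> both sides vanish because
      \<open>D x = 0\<close>.\<close>
    have DK: "has_bochner_integral lborel (\<lambda>u. D x * K x u) (D x * (Gamma (1 - \<alpha>) * Gamma \<alpha>))" for x
    proof (cases "x < T")
      case True
      then show ?thesis using K_int by (intro has_bochner_integral_mult_right)
    qed (simp add: D_def has_bochner_integral_zero)
    have int: "integrable (lborel \<Otimes>\<^sub>M lborel) (\<lambda>(x, u). D x * K x u)"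
    proof (rule lborel_pair.Fubini_integrable)
      have "(\<integral>u. norm (case (x, u) of (x, u) \<Rightarrow> D x * K x u) \<partial>lborel) =
          \<bar>D x\<bar> * (Gamma (1 - \<alpha>) * Gamma \<alpha>)" for x
      proof (cases "x < T")
        case True
        then show ?thesis
          using has_bochner_integral_integral_eq[OF K_int[OF True]] K_nonneg
          by (simp add: abs_mult)
      qed (simp add: D_def)
      then show "integrable lborel (\<lambda>x. \<integral>u. norm (case (x, u) of (x, u) \<Rightarrow> D x * K x u) \<partial>lborel)"
        using D_int by simp
      show "AE x in lborel. integrable lborel (\<lambda>u. case (x, u) of (x, u) \<Rightarrow> D x * K x u)"
        using DK by (auto simp: has_bochner_integral_iff)
    qed simp
    \<comment> \<open>Integrating over \<open>x\<close> first gives the Caputo integral at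
      \<open>u\<close>: the supports of \<open>D\<close> and \<open>K\<close> leave exactly
      \<open>0 < x < u < T\<close>.\<close>
    have inner: "(\<integral>x. D x * K x u \<partial>lborel) =
        Gamma (1 - \<alpha>) * (indicator {0<..<T} u * ((T - u) powr (\<alpha> - 1) * caputo_deriv \<alpha> f u))" for u
    proof -
      have "(\<integral>x. D x * K x u \<partial>lborel) =
          (\<integral>x. (indicator {0<..<T} u * (T - u) powr (\<alpha> - 1)) *
            (indicator {0<..<u} x * ((u - x) powr (-\<alpha>) * deriv f x)) \<partial>lborel)"
        by (intro Bochner_Integration.integral_cong) (auto simp: D_def K_def indicator_def)
      also have "\<dots> = indicator {0<..<T} u * (T - u) powr (\<alpha> - 1) *
          (\<integral>x. indicator {0<..<u} x * ((u - x) powr (-\<alpha>) * deriv f x) \<partial>lborel)"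
        by simp
      also have "(\<integral>x. indicator {0<..<u} x * ((u - x) powr (-\<alpha>) * deriv f x) \<partial>lborel) =
          Gamma (1 - \<alpha>) * caputo_deriv \<alpha> f u"
        using False Gamma_nz
        by (simp add: caputo_deriv_def set_lebesgue_integral_def)
      finally show ?thesis by simp
    qed
    have "Gamma (1 - \<alpha>) * (\<integral>u. indicator {0<..<T} u * ((T - u) powr (\<alpha> - 1) * caputo_deriv \<alpha> f u) \<partial>lborel) =
        (\<integral>u. (\<integral>x. D x * K x u \<partial>lborel) \<partial>lborel)"
      by (simp add: inner)
    also have "\<dots> = (\<integral>x. (\<integral>u. D x * K x u \<partial>lborel) \<partial>lborel)"
      using lborel_pair.Fubini_integral[OF int] .
    also have "\<dots> = (\<integral>x. D x * (Gamma (1 - \<alpha>) * Gamma \<alpha>) \<partial>lborel)"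
      by (simp only: has_bochner_integral_integral_eq[OF DK])
    also have "\<dots> = Gamma (1 - \<alpha>) * (Gamma \<alpha> * (f T - f 0))"
      by (simp add: FTC)
    finally show ?thesis using Gamma_nz by simp
  qed
qed

text \<open>The integrand is dominated by \<open>C * exp (- (s * t))\<close>, the Gamma kernel of
  order 1.\<close>

lemma set_integrable_laplace:
  fixes f :: "real \<Rightarrow> real"
  assumes s: "0 < s" and cont: "continuous_on {0..} f" and bound: "\<And>t. 0 \<le> t \<Longrightarrow> \<bar>f t\<bar> \<le> C"
  shows "set_integrable lborel {0..} (\<lambda>t. exp (- (s * t)) * f t)"
  unfolding set_integrable_def
proof (rule Bochner_Integration.integrable_bound)
  show "integrable lborel (\<lambda>t. C * (indicator {0<..} t * (exp (- (s * t)) * t powr (1 - 1))))"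
    using has_bochner_integral_Gamma_kernel[of 1 s] s
    by (intro integrable_mult_right) (simp add: has_bochner_integral_iff)
  have "continuous_on {0..} (\<lambda>t. exp (- (s * t)) * f t)"
    by (intro continuous_intros cont)
  then show "(\<lambda>t. indicator {0..} t *\<^sub>R (exp (- (s * t)) * f t)) \<in> borel_measurable lborel"
    by (auto dest: borel_measurable_continuous_on_indicator[rotated])
  \<comment> \<open>The dominating function is 0 at \<open>t = 0\<close>, so this point is excluded
    as a null set.\<close>
  have le: "norm (indicator {0..} t *\<^sub>R (exp (- (s * t)) * f t)) \<le>
      norm (C * (indicator {0<..} t * (exp (- (s * t)) * t powr (1 - 1))))" if "t \<noteq> 0" for t
    using bound[of t] that by (auto simp: indicator_def abs_mult)
  show "AE t in lborel. norm (indicator {0..} t *\<^sub>R (exp (- (s * t)) * f t)) \<le>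
      norm (C * (indicator {0<..} t * (exp (- (s * t)) * t powr (1 - 1))))"
    using AE_lborel_singleton[of 0] le by (rule eventually_mono)
qed

text \<open>Since \<open>exp (- (s * t)) = exp (- (s * u)) * exp (- (s * (t - u)))\<close>, the
  fractional integral equation multiplied by \<open>exp (- (s * t))\<close> is a convolution of the
  integrable functions \<open>F\<close> and \<open>K\<close>, and its integral is the product of
  theirs.\<close>

lemma laplace_transform_caputo:
  assumes \<alpha>: "0 < \<alpha>" "\<alpha> \<le> 1" and s: "0 < s"
    and f: "caputo_differentiable \<alpha> f" and f_bound: "\<And>t. 0 \<le> t \<Longrightarrow> \<bar>f t\<bar> \<le> B"
    and g: "continuous_on {0..} g" and g_bound: "\<And>t. 0 \<le> t \<Longrightarrow> \<bar>g t\<bar> \<le> C"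
    and eq: "\<And>t. 0 < t \<Longrightarrow> caputo_deriv \<alpha> f t = g t"
  shows "s powr \<alpha> * laplace_transform f s - s powr (\<alpha> - 1) * f 0 = laplace_transform g s"
proof -
  define F where "F = (\<lambda>u. indicator {0..} u * (exp (- (s * u)) * g u))"
  define K where "K = (\<lambda>v. indicator {0<..} v * (exp (- (s * v)) * v powr (\<alpha> - 1)))"
  have F: "integrable lborel F"
    using set_integrable_laplace[OF s g g_bound] by (simp add: F_def set_integrable_def)
  have F_int: "(\<integral>u. F u \<partial>lborel) = laplace_transform g s"
    by (simp add: F_def laplace_transform_def set_lebesgue_integral_def)
  have K: "integrable lborel K" and K_int: "(\<integral>v. K v \<partial>lborel) = Gamma \<alpha> / s powr \<alpha>"
    using has_bochner_integral_Gamma_kernel[OF \<alpha>(1) s] by (auto simp: K_def has_bochner_integral_iff)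
  have conv: "(\<integral>u. F u * K (t - u) \<partial>lborel) =
      indicator {0..} t * (Gamma \<alpha> * (exp (- (s * t)) * f t - f 0 * exp (- (s * t))))" for t
  proof (cases "0 < t")
    case True
    have "(\<integral>u. F u * K (t - u) \<partial>lborel) =
        (\<integral>u. exp (- (s * t)) * (indicator {0<..<t} u * ((t - u) powr (\<alpha> - 1) * caputo_deriv \<alpha> f u)) \<partial>lborel)"
    \<comment> \<open>At \<open>u = 0\<close> the left integrand may be nonzero while the open
      interval excludes the point; a single point does not change the integral.\<close>
    proof (rule integral_discrete_difference[where X="{0}"])
      fix u :: real assume "u \<notin> {0}"
      then show "F u * K (t - u) =
          exp (- (s * t)) * (indicator {0<..<t} u * ((t - u) powr (\<alpha> - 1) * caputo_deriv \<alpha> f u))"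
        using eq[of u] by (auto simp: F_def K_def indicator_def exp_diff exp_minus field_simps)
    qed auto
    also have "\<dots> = exp (- (s * t)) * (Gamma \<alpha> * (f t - f 0))"
    proof -
      \<comment> \<open>This supplies \<open>int1\<close> for the case \<open>\<alpha> = 1\<close>;
        it comes from continuity of \<open>g\<close> on a compact interval.\<close>
      have "set_integrable lborel {0<..<t} (caputo_deriv \<alpha> f)"
      proof -
        have "set_integrable lborel {0..t} g"
          using g by (intro borel_integrable_atLeastAtMost') (auto elim: continuous_on_subset)
        then have "set_integrable lborel {0<..<t} g"
          by (rule set_integrable_subset) auto
        also have "?this \<longleftrightarrow> ?thesis"
          using eq by (intro set_integrable_cong) auto
        finally show ?thesis .
      qed
      then have "(\<integral>u. indicator {0<..<t} u * ((t - u) powr (\<alpha> - 1) * caputo_deriv \<alpha> f u) \<partial>lborel) =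
          Gamma \<alpha> * (f t - f 0)"
        by (intro fractional_integral_caputo_deriv[OF \<alpha> f True])
      then show ?thesis by simp
    qed
    finally show ?thesis using True by (simp add: algebra_simps)
  next
    case False
    \<comment> \<open>A nonzero integrand would force \<open>0 \<le> u < t\<close>. On the right,
      \<open>t = 0\<close> gives \<open>f 0 - f 0\<close>, and the indicator removes
      \<open>t < 0\<close>.\<close>
    then have zero: "(\<lambda>u. F u * K (t - u)) = (\<lambda>u. 0)"
      by (auto simp: F_def K_def indicator_def)
    show ?thesis unfolding zero using False by (auto simp: indicator_def)
  qed
  have f_int: "set_integrable lborel {0..} (\<lambda>t. exp (- (s * t)) * f t)"
    using f f_bound by (intro set_integrable_laplace[OF s, of _ B]) (auto simp: caputo_differentiable_def)
  have one: "has_bochner_integral lborel (\<lambda>t. indicator {0..} t * exp (- (s * t))) (1 / s)"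
    using has_bochner_integral_Gamma_kernel[of 1 s] s
    by (subst has_bochner_integral_discrete_difference[where X="{0}"
          and g="\<lambda>t. indicator {0<..} t * (exp (- (s * t)) * t powr (1 - 1))"])
       (auto simp: indicator_def)
  have "Gamma \<alpha> * (laplace_transform f s - f 0 / s) =
      (\<integral>t. Gamma \<alpha> * (indicator {0..} t * (exp (- (s * t)) * f t) -
        f 0 * (indicator {0..} t * exp (- (s * t)))) \<partial>lborel)"
    using f_int one
    by (simp add: laplace_transform_def set_lebesgue_integral_def set_integrable_def has_bochner_integral_iff)
  also have "\<dots> = (\<integral>t. (\<integral>u. F u * K (t - u) \<partial>lborel) \<partial>lborel)"
    unfolding conv by (intro Bochner_Integration.integral_cong) (auto simp: algebra_simps)
  also have "\<dots> = Gamma \<alpha> * (laplace_transform g s / s powr \<alpha>)"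
    using integral_convolution[OF F K] F_int K_int by simp
  finally have "laplace_transform f s - f 0 / s = laplace_transform g s / s powr \<alpha>"
    by (simp only: mult_left_cancel[OF less_imp_neq[OF Gamma_real_pos[OF \<alpha>(1)], symmetric]])
  then have "s powr \<alpha> * (laplace_transform f s - f 0 / s) = laplace_transform g s"
    using s by simp
  moreover have "s powr (\<alpha> - 1) = s powr \<alpha> / s"
    using s by (simp add: powr_diff)
  ultimately show ?thesis by (simp add: algebra_simps)
qed

section \<open>Reduction of convolutions and Laplace transforms to finite sums\<close>

lemma discrete_convolution_nat:
  assumes "\<And>j. j < 0 \<Longrightarrow> a j = 0" "\<And>j. j < 0 \<Longrightarrow> b j = 0"
  shows "discrete_convolution a b (int n) = (\<Sum>j\<le>n. a (int j) * b (int (n - j)))"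
proof -
  have "discrete_convolution a b (int n) = (\<Sum>\<^sub>\<infinity>j\<in>int ` {..n}. a j * b (int n - j))"
    unfolding discrete_convolution_def
  proof (rule infsum_cong_neutral)
    fix j :: int assume "j \<in> UNIV - int ` {..n}"
    then have "j < 0 \<or> int n - j < 0"
      using nonneg_int_cases[of j] by (force simp: not_less)
    then show "a j * b (int n - j) = 0" using assms by auto
  qed auto
  also have "\<dots> = (\<Sum>j\<in>int ` {..n}. a j * b (int n - j))"
    by simp
  also have "\<dots> = (\<Sum>j\<le>n. a (int j) * b (int (n - j)))"
    by (subst sum.reindex) (auto intro!: sum.cong simp: of_nat_diff)
  finally show ?thesis .
qed

text \<open>Shifting the index of the second convolution by one pairs its terms with those of the
  first, so that differences of consecutive intensities appear as weights.\<close>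

lemma discrete_convolution_diff:
  assumes a: "\<And>j. j < 0 \<Longrightarrow> a j = 0" and b: "\<And>j. j < 0 \<Longrightarrow> b j = 0"
  shows "- discrete_convolution a b (int n) + discrete_convolution a b (int n - 1) =
    - a 0 * b (int n) + (\<Sum>j=1..n. (a (int j - 1) - a (int j)) * b (int (n - j)))"
proof -
  have "discrete_convolution a b (int n - 1) = (\<Sum>j=1..n. a (int j - 1) * b (int (n - j)))"
  proof (cases n)
    case 0
    \<comment> \<open>For \<open>n = 0\<close> the second convolution is taken at -1, where every
      \<open>j\<close> makes one of the two arguments negative.\<close>
    have "a j * b (- 1 - j) = 0" for j
      using a[of j] b[of "- 1 - j"] by (cases "j < 0") auto
    then have "(\<lambda>j. a j * b (- 1 - j)) = (\<lambda>j. 0)" by blast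
    then show ?thesis using 0 by (simp only: discrete_convolution_def) simp
  next
    case (Suc m)
    then have "discrete_convolution a b (int n - 1) = (\<Sum>j\<le>m. a (int j) * b (int (m - j)))"
      using discrete_convolution_nat[of a b m, OF a b] by simp
    also have "\<dots> = (\<Sum>j=1..n. a (int j - 1) * b (int (n - j)))"
      by (rule sum.reindex_bij_witness[of _ "\<lambda>j. j - 1" Suc]) (auto simp: Suc)
    finally show ?thesis .
  qed
  moreover have "discrete_convolution a b (int n) =
      a 0 * b (int n) + (\<Sum>j=1..n. a (int j) * b (int (n - j)))"
  proof -
    have "{..n} - {0} = {1..n}" by auto
    then show ?thesis
      using discrete_convolution_nat[of a b n, OF a b] by (simp add: sum.remove[of "{..n}" 0])
  qed
  ultimately show ?thesis
    by (simp add: algebra_simps sum_subtractf)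
qed

lemma laplace_transform_linear_combination:
  assumes "\<And>i. i \<in> I \<Longrightarrow> set_integrable lborel {0..} (\<lambda>t. exp (- (s * t)) * f i t)"
  shows "laplace_transform (\<lambda>t. \<Sum>i\<in>I. c i * f i t) s = (\<Sum>i\<in>I. c i * laplace_transform (f i) s)"
proof -
  have "laplace_transform (\<lambda>t. \<Sum>i\<in>I. c i * f i t) s =
      (\<integral>t. (\<Sum>i\<in>I. c i * (indicator {0..} t * (exp (- (s * t)) * f i t))) \<partial>lborel)"
    unfolding laplace_transform_def set_lebesgue_integral_def
    by (intro Bochner_Integration.integral_cong refl) (simp add: sum_distrib_left mult_ac)
  also have "\<dots> = (\<Sum>i\<in>I. c i * laplace_transform (f i) s)"
    unfolding laplace_transform_def set_lebesgue_integral_def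
    using assms by (subst Bochner_Integration.integral_sum) (auto simp: set_integrable_def)
  finally show ?thesis .
qed

section \<open>Laplace transforms of the state probabilities\<close>

context
  fixes M :: "'w measure" and N :: "real \<Rightarrow> 'w \<Rightarrow> nat" and lam :: "int \<Rightarrow> real" and \<alpha> s :: real
  assumes \<alpha>: "0 < \<alpha>" "\<alpha> \<le> 1" and lam: "intensity_parameters lam"
    and N: "convoluted_fractional_poisson M \<alpha> lam N" and s: "0 < s"
begin

lemma abs_state_prob_le_1: "\<bar>state_prob M N n t\<bar> \<le> 1"
proof -
  interpret prob_space M
    using N by (simp add: convoluted_fractional_poisson_def)
  show ?thesis by (simp add: state_prob_def)
qed

lemma state_prob_continuous: "continuous_on {0..} (state_prob M N (int n))"
  using N by (simp add: convoluted_fractional_poisson_def caputo_differentiable_def)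

lemma state_prob_laplace_integrable:
  "set_integrable lborel {0..} (\<lambda>t. exp (- (s * t)) * state_prob M N (int n) t)"
  using s state_prob_continuous abs_state_prob_le_1 by (rule set_integrable_laplace)

text \<open>The state equation is transformed by \<open>laplace_transform_caputo\<close>, and its
  loss term with rate \<open>lam 0\<close> is moved to the left.\<close>

lemma laplace_state_prob_recursion:
  "(s powr \<alpha> + lam 0) * laplace_transform (state_prob M N (int n)) s =
    s powr (\<alpha> - 1) * state_prob M N (int n) 0 +
    (\<Sum>j=1..n. (lam (int j - 1) - lam (int j)) * laplace_transform (state_prob M N (int (n - j))) s)"
proof -
  \<comment> \<open>The weight \<open>- lam 0\<close> at index 0 absorbs the loss term, so
    \<open>g\<close> is one finite linear combination of state probabilities, hence continuous and
    bounded by the sum of the \<open>\<bar>c j\<bar>\<close>.\<close>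
  define c where "c j = (if j = 0 then - lam 0 else lam (int j - 1) - lam (int j))" for j
  define g where "g = (\<lambda>t. \<Sum>j\<le>n. c j * state_prob M N (int (n - j)) t)"
  have split: "(\<Sum>j\<le>n. c j * h j) = - lam 0 * h 0 + (\<Sum>j=1..n. (lam (int j - 1) - lam (int j)) * h j)" for h
  proof -
    have "{..n} - {0} = {1..n}" by auto
    then show ?thesis by (simp add: sum.remove[of "{..n}" 0] c_def)
  qed
  have eq: "caputo_deriv \<alpha> (state_prob M N (int n)) t = g t" if "0 < t" for t
  proof -
    have "caputo_deriv \<alpha> (state_prob M N (int n)) t =
        - discrete_convolution lam (\<lambda>m. state_prob M N m t) (int n)
        + discrete_convolution lam (\<lambda>m. state_prob M N m t) (int n - 1)"
      using N that by (simp add: convoluted_fractional_poisson_def)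
    also have "\<dots> = g t"
      \<comment> \<open>Negative states have probability 0 because \<open>N\<close> takes values in
        the naturals.\<close>
      using lam unfolding g_def split
      by (subst discrete_convolution_diff) (auto simp: intensity_parameters_def state_prob_def)
    finally show ?thesis .
  qed
  have "s powr \<alpha> * laplace_transform (state_prob M N (int n)) s
      - s powr (\<alpha> - 1) * state_prob M N (int n) 0 = laplace_transform g s"
  proof (rule laplace_transform_caputo[OF \<alpha> s _ abs_state_prob_le_1 _ _ eq])
    show "caputo_differentiable \<alpha> (state_prob M N (int n))"
      using N by (simp add: convoluted_fractional_poisson_def)
    show "continuous_on {0..} g"
      unfolding g_def by (intro continuous_intros state_prob_continuous)
    show "\<bar>g t\<bar> \<le> (\<Sum>j\<le>n. \<bar>c j\<bar>)" for t
    proof -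
      have "\<bar>g t\<bar> \<le> (\<Sum>j\<le>n. \<bar>c j * state_prob M N (int (n - j)) t\<bar>)"
        unfolding g_def by (rule sum_abs)
      also have "\<dots> \<le> (\<Sum>j\<le>n. \<bar>c j\<bar>)"
        using abs_state_prob_le_1 by (intro sum_mono) (simp add: abs_mult mult_left_le)
      finally show ?thesis .
    qed
  qed auto
  also have "laplace_transform g s = (\<Sum>j\<le>n. c j * laplace_transform (state_prob M N (int (n - j))) s)"
    unfolding g_def using state_prob_laplace_integrable
    by (intro laplace_transform_linear_combination)
  finally show ?thesis
    unfolding split by (simp add: algebra_simps)
qed

end

theorem proposition3p1:
  fixes M :: "'w measure" and N :: "real \<Rightarrow> 'w \<Rightarrow> nat"
    and lam :: "int \<Rightarrow> real" and \<alpha> s :: real and n :: nat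
  assumes "0 < \<alpha>" and "\<alpha> \<le> 1"
    and "intensity_parameters lam"
    and "convoluted_fractional_poisson M \<alpha> lam N"
    and "s > 0"
  shows "set_integrable lborel {0..} (\<lambda>t. exp (- (s * t)) * state_prob M N (int n) t) \<and>
    laplace_transform (state_prob M N (int n)) s =
      (if n = 0 then s powr (\<alpha> - 1) / (s powr \<alpha> + lam 0)
       else (\<Sum>k=1..n. \<Sum>\<kappa>\<in>Theta n k.
               fact k * (\<Prod>j=1..n. (lam (int j - 1) - lam (int j)) ^ \<kappa> j / fact (\<kappa> j))
               * (s powr (\<alpha> - 1) / (s powr \<alpha> + lam 0) ^ (k + 1))))"
proof
  show "set_integrable lborel {0..} (\<lambda>t. exp (- (s * t)) * state_prob M N (int n) t)"
    using assms by (rule state_prob_laplace_integrable)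
  define a b d where "a = s powr (\<alpha> - 1)" and "b = s powr \<alpha> + lam 0"
    and "d = (\<lambda>j. lam (int j - 1) - lam (int j))"
  define L where "L = (\<lambda>n. laplace_transform (state_prob M N (int n)) s)"
  have "lam 0 > 0" using assms(3) by (simp add: intensity_parameters_def)
  then have "b > 0" by (simp add: b_def add_nonneg_pos)
  have rec: "b * L n = a * state_prob M N (int n) 0 + (\<Sum>j=1..n. d j * L (n - j))" for n
    unfolding a_def b_def d_def L_def using assms by (rule laplace_state_prob_recursion)
  have init: "state_prob M N 0 0 = 1" "\<And>n. 1 \<le> n \<Longrightarrow> state_prob M N (int n) 0 = 0"
    using assms(4) by (auto simp: convoluted_fractional_poisson_def)
  have L0: "L 0 = a / b"
    using rec[of 0] init(1) \<open>b > 0\<close> by (simp add: field_simps)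
  have "L n = (\<Sum>j=1..n. d j * L (n - j)) / b" if "1 \<le> n" for n
    using rec[of n] init(2)[OF that] \<open>b > 0\<close> by (simp add: field_simps)
  \<comment> \<open>Taking \<open>m = n\<close> makes the index sets coincide with
    \<open>Theta n k\<close>.\<close>
  then have "L n = (\<Sum>k\<le>n. composition_sum d n n k * (a / b ^ (k + 1)))"
    by (rule recursion_eq_composition_sum[where L = L, OF L0]) auto
  \<comment> \<open>The term \<open>k = 0\<close> vanishes for \<open>n \<noteq> 0\<close>, so the
    sum starts at 1.\<close>
  also have "\<dots> = (\<Sum>k=1..n. composition_sum d n n k * (a / b ^ (k + 1)))" if "n \<noteq> 0"
    using that by (intro sum.mono_neutral_right) (auto simp: composition_sum_zero_right not_less_eq_eq)
  finally have "L n = (\<Sum>k=1..n. \<Sum>\<kappa>\<in>Theta n k.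
      fact k * (\<Prod>j=1..n. d j ^ \<kappa> j / fact (\<kappa> j)) * (a / b ^ (k + 1)))" if "n \<noteq> 0"
    unfolding sum_Theta_eq_composition_sum[symmetric] sum_distrib_right using that by blast
  then show "laplace_transform (state_prob M N (int n)) s =
      (if n = 0 then s powr (\<alpha> - 1) / (s powr \<alpha> + lam 0)
       else (\<Sum>k=1..n. \<Sum>\<kappa>\<in>Theta n k.
               fact k * (\<Prod>j=1..n. (lam (int j - 1) - lam (int j)) ^ \<kappa> j / fact (\<kappa> j))
               * (s powr (\<alpha> - 1) / (s powr \<alpha> + lam 0) ^ (k + 1))))"
    using L0 unfolding L_def a_def b_def d_def by auto
qed

end
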